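(* Suppose Assumptions (i)–(iii) of the context hold. Let $\varepsilon,\delta\ge 0$, let $\tilde{x}\in\mathbb{R}^d$ be an approximate lower-level solution with $\|\tilde{x}-x^*\|\le\varepsilon$, let $\tilde{q}\in\mathbb{R}^d$ be an approximate solution of $A(\tilde{x})q=\nabla f(\tilde{x})$ with $\|A(\tilde{x})\tilde{q}-\nabla f(\tilde{x})\|\le\delta$, and let $\tilde{h} := -B(\tilde{x})^T\tilde{q}$. Let $L_{A^{-1}}$ be a Lipschitz constant of the map $x\mapsto A(x)^{-1}$ (which exists under these assumptions), and define $$c(x) := \frac{L_{\nabla f}\|B(x)\|}{\mu} + L_{A^{-1}}\|\nabla f(x)\|\,\|B(x)\| + \frac{L_B\|\nabla f(x)\|}{\mu}.$$ Then the following a priori bound holds: $$\|\tilde{h}-h^*\| \le c(x^* )\,\varepsilon + \frac{\|B(x^* )\|}{\mu}\,\delta + \frac{L_B L_{\nabla f}}{\mu}\,\varepsilon^2 + \frac{L_B}{\mu}\,\delta\varepsilon.$$ In particular, $\|\tilde{h}-h^*\| = \mathcal{O}(\varepsilon+\delta+\varepsilon^2+\delta^2)$ (with constant independent of $\varepsilon,\delta,\tilde{x},\tilde{q}$), and $\|\tilde{h}-h^*\|\to 0$ as $\varepsilon,\delta\to 0$.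
   Context: Setting: $g:\mathbb{R}^d\times\mathbb{R}^n\to\mathbb{R}$, $(y,\theta)\mapsto g(y,\theta)$, is the lower-level objective and $f:\mathbb{R}^d\to\mathbb{R}$ the differentiable upper-level function of a bilevel problem. $\|\cdot\|$ is the Euclidean norm for vectors and the operator 2-norm for matrices. The parameter $\theta\in\mathbb{R}^n$ is fixed and dropped from the notation: $A(y) := \partial_{yy} g(y,\theta)\in\mathbb{R}^{d\times d}$ is the Hessian in $y$; $B(y) := \partial_y\partial_\theta g(y,\theta)\in\mathbb{R}^{d\times n}$ is the Jacobian of $\partial_y g$ with respect to $\theta$, $[B(y)]_{j,k} = \partial^2 g(y,\theta)/(\partial y_j\partial\theta_k)$; $x^* := \operatorname{arg\,min}_{x\in\mathbb{R}^d} g(x,\theta)$ is the unique lower-level minimizer; $\mu=\mu(\theta)$, $L=L(\theta)$. The exact hypergradient is $h^* := -B(x^* )^T A(x^* )^{-1}\nabla f(x^* )\in\mathbb{R}^n$. Assumptions: (i) $g$ is twice continuously differentiable in $y$ and there exist $0<\mu(\theta)\le L(\theta)$ such that $\mu(\theta) I \preceq \partial_{yy} g(y,\theta)\preceq L(\theta) I$ for all $y$ (where $M\preceq N$ means $N-M$ is positive semidefinite); moreover $g$, $\partial_y g$ and $\partial_{yy} g$ are continuous in $\theta$. (ii) $A$ and $B$ are Lipschitz continuous in $y$ with constants $L_A$ and $L_B$ respectively, uniformly for all $\theta$. (iii) $\nabla f$ is Lipschitz continuous with constant $L_{\nabla f}$. *)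

theory Defs
  imports "HOL-Analysis.Analysis"
begin

definition gradient :: "('a::real_inner \<Rightarrow> real) \<Rightarrow> 'a \<Rightarrow> 'a" where
  "gradient h x = (THE D. GDERIV h x :> D)"

definition hessian :: "(real^'d \<Rightarrow> real) \<Rightarrow> real^'d \<Rightarrow> real^'d^'d" where
  "hessian h x = jacobian (gradient h) (at x)"

definition twice_cont_diff :: "(real^'d \<Rightarrow> real) \<Rightarrow> bool" where
  "twice_cont_diff h \<longleftrightarrow>
     (\<forall>x. h differentiable (at x)) \<and>
     (\<forall>x. gradient h differentiable (at x)) \<and>
     continuous_on UNIV (hessian h)"

text \<open>The norm of the type \<open>real^'n^'m\<close> is the Frobenius norm, so the operator norm induced by the
  Euclidean norms is written out, as is Lipschitz continuity of matrix-valued maps with respect to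
  it.\<close>

definition opnorm :: "real^'n^'m \<Rightarrow> real" where
  "opnorm M = onorm (\<lambda>v. M *v v)"

definition opnorm_lipschitz :: "real \<Rightarrow> (real^'d \<Rightarrow> real^'n^'m) \<Rightarrow> bool" where
  "opnorm_lipschitz C F \<longleftrightarrow> 0 \<le> C \<and> (\<forall>x y. opnorm (F x - F y) \<le> C * norm (x - y))"

definition pos_semidef :: "real^'d^'d \<Rightarrow> bool" where
  "pos_semidef M \<longleftrightarrow> transpose M = M \<and> (\<forall>v. 0 \<le> v \<bullet> (M *v v))"

definition loewner_le :: "real^'d^'d \<Rightarrow> real^'d^'d \<Rightarrow> bool"  (infix \<open>\<preceq>\<^sub>L\<close> 50) where
  "M \<preceq>\<^sub>L N \<longleftrightarrow> pos_semidef (N - M)"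

definition grad_y :: "(real^'d \<Rightarrow> real^'n \<Rightarrow> real) \<Rightarrow> real^'d \<Rightarrow> real^'n \<Rightarrow> real^'d" where
  "grad_y g y \<theta> = gradient (\<lambda>z. g z \<theta>) y"

definition hess_yy :: "(real^'d \<Rightarrow> real^'n \<Rightarrow> real) \<Rightarrow> real^'d \<Rightarrow> real^'n \<Rightarrow> real^'d^'d" where
  "hess_yy g y \<theta> = hessian (\<lambda>z. g z \<theta>) y"

text \<open>Rows of \<open>jac_mixed g y \<theta>\<close> are indexed by the components of \<open>y\<close>, columns by those of
  \<open>\<theta>\<close>.\<close>

definition jac_mixed :: "(real^'d \<Rightarrow> real^'n \<Rightarrow> real) \<Rightarrow> real^'d \<Rightarrow> real^'n \<Rightarrow> real^'n^'d" where
  "jac_mixed g y \<theta> = jacobian (\<lambda>\<tau>. grad_y g y \<tau>) (at \<theta>)"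

text \<open>\<open>arg_min\<close> is a Hilbert choice; \<open>ex1_lower_minimizer\<close> below shows that under the
  strong convexity assumption the minimizer exists and is unique.\<close>

definition lower_minimizer :: "(real^'d \<Rightarrow> real^'n \<Rightarrow> real) \<Rightarrow> real^'n \<Rightarrow> real^'d" where
  "lower_minimizer g \<theta> = arg_min (\<lambda>y. g y \<theta>) (\<lambda>_. True)"

definition hypergradient ::
    "(real^'d \<Rightarrow> real^'n \<Rightarrow> real) \<Rightarrow> (real^'d \<Rightarrow> real) \<Rightarrow> real^'n \<Rightarrow> real^'n" where
  "hypergradient g f \<theta> =
     (let xs = lower_minimizer g \<theta> in
      - (transpose (jac_mixed g xs \<theta>) *v (matrix_inv (hess_yy g xs \<theta>) *v gradient f xs)))"

definition approx_hypergradient ::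
    "(real^'d \<Rightarrow> real^'n \<Rightarrow> real) \<Rightarrow> real^'n \<Rightarrow> real^'d \<Rightarrow> real^'d \<Rightarrow> real^'n" where
  "approx_hypergradient g \<theta> x q = - (transpose (jac_mixed g x \<theta>) *v q)"

definition approx_solutions ::
    "(real^'d \<Rightarrow> real^'n \<Rightarrow> real) \<Rightarrow> (real^'d \<Rightarrow> real) \<Rightarrow> real^'n
      \<Rightarrow> real \<Rightarrow> real \<Rightarrow> real^'d \<Rightarrow> real^'d \<Rightarrow> bool" where
  "approx_solutions g f \<theta> \<epsilon> \<delta> x q \<longleftrightarrow>
     norm (x - lower_minimizer g \<theta>) \<le> \<epsilon> \<and>
     norm (hess_yy g x \<theta> *v q - gradient f x) \<le> \<delta>"

definition error_coeff ::
    "(real^'d \<Rightarrow> real^'n \<Rightarrow> real) \<Rightarrow> (real^'d \<Rightarrow> real) \<Rightarrow> real^'n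
      \<Rightarrow> real \<Rightarrow> real \<Rightarrow> real \<Rightarrow> real \<Rightarrow> real^'d \<Rightarrow> real" where
  "error_coeff g f \<theta> \<mu> L\<^sub>B L\<^sub>f L\<^sub>i x =
     L\<^sub>f * opnorm (jac_mixed g x \<theta>) / \<mu>
     + L\<^sub>i * norm (gradient f x) * opnorm (jac_mixed g x \<theta>)
     + L\<^sub>B * norm (gradient f x) / \<mu>"

lemma has_derivative_gradient:
  fixes h :: "'a::euclidean_space \<Rightarrow> real"
  assumes "h differentiable (at x)"
  shows "(h has_derivative (\<lambda>v. v \<bullet> gradient h x)) (at x)"
proof -
  from assms obtain h' where h': "(h has_derivative h') (at x)"
    by (auto simp: differentiable_def)
  then have lin: "linear h'"
    by (rule has_derivative_linear)
  have "h' = (\<lambda>v. v \<bullet> adjoint h' 1)"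
    using adjoint_works[OF lin, of _ 1] by (auto simp: inner_commute)
  with h' have ex: "GDERIV h x :> adjoint h' 1"
    by (simp add: gderiv_def)
  have "D = adjoint h' 1" if "GDERIV h x :> D" for D
  proof -
    have "(\<lambda>v. v \<bullet> D) = (\<lambda>v. v \<bullet> adjoint h' 1)"
      using that ex has_derivative_unique unfolding gderiv_def by blast
    then show ?thesis
      by (metis vector_eq_ldot)
  qed
  with ex have "GDERIV h x :> gradient h x"
    unfolding gradient_def by (metis theI)
  then show ?thesis
    by (simp add: gderiv_def)
qed

lemma strongly_convex_lower_bound:
  fixes h :: "real^'d \<Rightarrow> real"
  assumes h: "twice_cont_diff h" and \<mu>: "\<And>x. \<mu> *\<^sub>R mat 1 \<preceq>\<^sub>L hessian h x"
  shows "h x + (y - x) \<bullet> gradient h x + \<mu> / 2 * (norm (y - x))\<^sup>2 \<le> h y"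
proof -
  define d where "d = y - x"
  define p where "p t = d \<bullet> gradient h (x + t *\<^sub>R d)" for t
  have dh: "((\<lambda>t. h (x + t *\<^sub>R d)) has_real_derivative p t) (at t)" for t
  proof -
    have "(h has_derivative (\<lambda>v. v \<bullet> gradient h (x + t *\<^sub>R d))) (at (x + t *\<^sub>R d))"
      using h by (intro has_derivative_gradient) (simp add: twice_cont_diff_def)
    moreover have "((\<lambda>t. x + t *\<^sub>R d) has_derivative (\<lambda>s. s *\<^sub>R d)) (at t)"
      by (auto intro!: derivative_eq_intros)
    ultimately have "((\<lambda>t. h (x + t *\<^sub>R d)) has_derivative
        (\<lambda>s. (s *\<^sub>R d) \<bullet> gradient h (x + t *\<^sub>R d))) (at t)"
      by (rule has_derivative_compose[rotated])
    then show ?thesis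
      by (simp add: has_field_derivative_def p_def mult_commute_abs)
  qed
  have dp: "(p has_real_derivative d \<bullet> (hessian h (x + t *\<^sub>R d) *v d)) (at t)" for t
  proof -
    have "(gradient h has_derivative (\<lambda>v. hessian h (x + t *\<^sub>R d) *v v)) (at (x + t *\<^sub>R d))"
      using h unfolding hessian_def by (simp add: twice_cont_diff_def flip: jacobian_works)
    moreover have "((\<lambda>t. x + t *\<^sub>R d) has_derivative (\<lambda>s. s *\<^sub>R d)) (at t)"
      by (auto intro!: derivative_eq_intros)
    ultimately have "((\<lambda>t. gradient h (x + t *\<^sub>R d)) has_derivative
        (\<lambda>s. hessian h (x + t *\<^sub>R d) *v (s *\<^sub>R d))) (at t)"
      by (rule has_derivative_compose[rotated])
    then have "(p has_derivative (\<lambda>s. d \<bullet> (hessian h (x + t *\<^sub>R d) *v (s *\<^sub>R d)))) (at t)"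
      unfolding p_def by (rule has_derivative_inner_right)
    then show ?thesis
      by (simp add: has_field_derivative_def matrix_vector_mult_scaleR mult_commute_abs)
  qed
  have curv: "\<mu> * (norm d)\<^sup>2 \<le> d \<bullet> (hessian h z *v d)" for z
  proof -
    have "0 \<le> d \<bullet> ((hessian h z - \<mu> *\<^sub>R mat 1) *v d)"
      using \<mu>[of z] by (simp add: loewner_le_def pos_semidef_def)
    then show ?thesis
      by (simp add: matrix_vector_mult_diff_rdistrib scaleR_matrix_vector_assoc[symmetric]
          inner_diff_right power2_norm_eq_inner)
  qed
  have p: "p 0 + \<mu> * t * (norm d)\<^sup>2 \<le> p t" if "0 \<le> t" for t
  proof -
    have "p 0 - \<mu> * (norm d)\<^sup>2 * 0 \<le> p t - \<mu> * (norm d)\<^sup>2 * t"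
    proof (rule DERIV_nonneg_imp_nondecreasing[OF that])
      show "\<exists>k. ((\<lambda>s. p s - \<mu> * (norm d)\<^sup>2 * s) has_real_derivative k) (at s) \<and> 0 \<le> k" for s
        using curv[of "x + s *\<^sub>R d"]
        by (intro exI[of _ "d \<bullet> (hessian h (x + s *\<^sub>R d) *v d) - \<mu> * (norm d)\<^sup>2"] conjI)
           (auto intro!: derivative_eq_intros dp)
    qed
    then show ?thesis
      by (simp add: algebra_simps)
  qed
  define r where "r s = h (x + s *\<^sub>R d) - s * p 0 - \<mu> / 2 * (norm d)\<^sup>2 * s\<^sup>2" for s
  have "r 0 \<le> r 1"
  proof (rule DERIV_nonneg_imp_nondecreasing[of 0 1 r])
    fix s :: real
    assume "0 \<le> s"
    show "\<exists>k. (r has_real_derivative k) (at s) \<and> 0 \<le> k"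
      using p[OF \<open>0 \<le> s\<close>] unfolding r_def
      by (intro exI[of _ "p s - p 0 - \<mu> * s * (norm d)\<^sup>2"] conjI)
         (auto intro!: derivative_eq_intros dh)
  qed simp
  then show ?thesis
    by (simp add: r_def d_def p_def)
qed

lemma ex1_lower_minimizer:
  fixes g :: "real^'d \<Rightarrow> real^'n \<Rightarrow> real"
  assumes g: "twice_cont_diff (\<lambda>y. g y \<theta>)"
    and "0 < \<mu>" and \<mu>: "\<And>y. \<mu> *\<^sub>R mat 1 \<preceq>\<^sub>L hess_yy g y \<theta>"
  shows "\<exists>!x. is_arg_min (\<lambda>y. g y \<theta>) (\<lambda>_. True) x"
proof -
  define h where "h = (\<lambda>y. g y \<theta>)"
  have diff: "h differentiable (at x)" for x
    using g by (simp add: h_def twice_cont_diff_def)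
  have lb: "h x + (y - x) \<bullet> gradient h x + \<mu> / 2 * (norm (y - x))\<^sup>2 \<le> h y" for x y
    using strongly_convex_lower_bound[of h \<mu>] g \<mu> by (simp add: h_def hess_yy_def)
  define R where "R = 2 * norm (gradient h 0) / \<mu>"
  have "0 \<le> R"
    using \<open>0 < \<mu>\<close> by (simp add: R_def)
  have "continuous_on (cball 0 R) h"
    using diff by (meson continuous_at_imp_continuous_on differentiable_imp_continuous_within)
  then obtain x where x: "x \<in> cball 0 R" "\<And>y. y \<in> cball 0 R \<Longrightarrow> h x \<le> h y"
    using continuous_attains_inf[of "cball 0 R" h] \<open>0 \<le> R\<close> by auto
  have min: "h x \<le> h y" for y
  proof (cases "norm y \<le> R")
    case False
    then have "2 * norm (gradient h 0) \<le> \<mu> * norm y"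
      using \<open>0 < \<mu>\<close> by (simp add: R_def field_simps)
    then have "norm (gradient h 0) * norm y \<le> \<mu> / 2 * norm y * norm y"
      by (intro mult_right_mono) auto
    moreover have "- (norm y * norm (gradient h 0)) \<le> y \<bullet> gradient h 0"
      using Cauchy_Schwarz_ineq2[of y "gradient h 0"] by linarith
    ultimately have "h 0 \<le> h y"
      using lb[of 0 y] by (simp add: power2_eq_square algebra_simps)
    moreover have "h x \<le> h 0"
      using x(2)[of 0] \<open>0 \<le> R\<close> by simp
    ultimately show ?thesis by linarith
  qed (use x(2) in simp)
  have "z = x" if "\<And>y. h z \<le> h y" for z
  proof -
    have "(\<lambda>v. v \<bullet> gradient h x) = (\<lambda>v. 0)"
      using differential_zero_maxmin[of x UNIV h, OF _ _ has_derivative_gradient[OF diff]] min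
      by simp
    then have "gradient h x = 0"
      by (metis inner_eq_zero_iff)
    then have "\<mu> / 2 * (norm (z - x))\<^sup>2 \<le> 0"
      using lb[of x z] that[of x] by simp
    then show ?thesis
      using \<open>0 < \<mu>\<close> by (simp add: mult_le_0_iff)
  qed
  with min show ?thesis
    unfolding is_arg_min_linorder h_def by blast
qed

end

theory Submission
  imports Defs
begin

text \<open>Write \<open>A\<close>, \<open>B\<close> for the Hessian and the mixed derivative at the approximate solution \<open>x\<close>, and
  a star for the same objects at the minimizer, and let \<open>w = A*\<^sup>-\<^sup>1 \<nabla>f*\<close>. The error is split as
  \<open>B\<^sup>T q - B*\<^sup>T w = (B - B*)\<^sup>T q + B*\<^sup>T (q - w)\<close>. Strong convexity bounds \<open>A\<^sup>-\<^sup>1\<close> by \<open>1/\<mu>\<close>, so the residual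
  condition yields \<open>\<mu> \<parallel>q\<parallel> \<le> \<parallel>\<nabla>f*\<parallel> + L\<^sub>f \<epsilon> + \<delta>\<close>, while \<open>q - w\<close> is the sum of \<open>A\<^sup>-\<^sup>1 (A q - \<nabla>f)\<close>,
  \<open>A\<^sup>-\<^sup>1 (\<nabla>f - \<nabla>f*)\<close> and \<open>(A\<^sup>-\<^sup>1 - A*\<^sup>-\<^sup>1) \<nabla>f*\<close>. Splitting off \<open>B\<^sup>T (q - w)\<close> instead would leave an
  additional term \<open>L\<^sub>B L\<^sub>i \<parallel>\<nabla>f*\<parallel> \<epsilon>\<^sup>2\<close>.\<close>

section \<open>Operator norms and transposes\<close>

lemma opnorm_nonneg: "0 \<le> opnorm M"
  unfolding opnorm_def by (rule onorm_pos_le) (rule matrix_vector_mul_bounded_linear)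

lemma norm_mult_le_opnorm: "norm (M *v v) \<le> opnorm M * norm v"
  unfolding opnorm_def by (rule onorm) (rule matrix_vector_mul_bounded_linear)

lemma opnorm_leI:
  assumes "\<And>v. norm (M *v v) \<le> C * norm v"
  shows "opnorm M \<le> C"
  unfolding opnorm_def using assms by (rule onorm_le)

text \<open>Test \<open>u = transpose M *v v\<close> against itself, move \<open>M\<close> across
  the inner product, and cancel one factor \<open>norm u\<close>. This lets the error be measured by
  \<open>opnorm (B x - B s)\<close> although only transposes act on vectors.\<close>

lemma norm_transpose_mult_le_opnorm:
  fixes M :: "real^'n^'m"
  shows "norm (transpose M *v v) \<le> opnorm M * norm v"
proof -
  define u where "u = transpose M *v v"
  have "norm u * norm u = u \<bullet> (transpose M *v v)"
    by (simp add: u_def flip: power2_norm_eq_inner power2_eq_square)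
  also have "\<dots> = v \<bullet> (M *v u)"
    by (metis dot_lmul_matrix inner_commute transpose_matrix_vector)
  also have "\<dots> \<le> norm v * (opnorm M * norm u)"
    by (meson norm_cauchy_schwarz norm_mult_le_opnorm mult_left_mono norm_ge_zero order_trans)
  finally have "norm u * norm u \<le> (opnorm M * norm v) * norm u"
    by (simp add: algebra_simps)
  then show ?thesis
    unfolding u_def[symmetric]
    by (cases "norm u = 0") (auto simp: opnorm_nonneg mult_le_cancel_right)
qed

section \<open>Inverses of matrices bounded below by a positive multiple of the identity\<close>

lemma loewner_le_coercive:
  fixes M :: "real^'d^'d"
  assumes "\<mu> *\<^sub>R mat 1 \<preceq>\<^sub>L M"
  shows "\<mu> * norm v \<le> norm (M *v v)"
proof (cases "v = 0")
  case False
  have "0 \<le> v \<bullet> ((M - \<mu> *\<^sub>R mat 1) *v v)"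
    using assms by (simp add: loewner_le_def pos_semidef_def)
  then have "\<mu> * norm v * norm v \<le> v \<bullet> (M *v v)"
    by (simp add: matrix_vector_mult_diff_rdistrib scaleR_matrix_vector_assoc[symmetric]
        inner_diff_right power2_norm_eq_inner[symmetric] power2_eq_square)
  also have "\<dots> \<le> norm (M *v v) * norm v"
    using norm_cauchy_schwarz[of v "M *v v"] by (simp add: mult.commute)
  finally show ?thesis
    using False by simp
qed simp

text \<open>Coercivity makes the kernel trivial; for a square matrix this gives a left inverse,
  which is two-sided.\<close>

lemma loewner_le_invertible:
  fixes M :: "real^'d^'d"
  assumes "0 < \<mu>" and M: "\<mu> *\<^sub>R mat 1 \<preceq>\<^sub>L M"
  shows "invertible M"
proof -
  have "v = 0" if "M *v v = 0" for v
    using loewner_le_coercive[OF M, of v] that \<open>0 < \<mu>\<close> by (simp add: mult_le_0_iff)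
  then show ?thesis
    using invertible_left_inverse matrix_left_invertible_ker by blast
qed

lemma matrix_inv_mult_vector:
  fixes M :: "real^'d^'d"
  assumes "invertible M"
  shows "M *v (matrix_inv M *v v) = v" and "matrix_inv M *v (M *v v) = v"
  \<comment> \<open>\<open>matrix_inv\<close> is a Hilbert choice, so both inverse laws must be
    extracted from the existence statement.\<close>
  using someI_ex[OF assms[unfolded invertible_def]]
  by (simp_all add: matrix_vector_mul_assoc matrix_inv_def)

lemma norm_matrix_inv_mult_le:
  fixes M :: "real^'d^'d"
  assumes "0 < \<mu>" and M: "\<mu> *\<^sub>R mat 1 \<preceq>\<^sub>L M"
  shows "norm (matrix_inv M *v v) \<le> norm v / \<mu>"
  using loewner_le_coercive[OF M, of "matrix_inv M *v v"] \<open>0 < \<mu>\<close>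
    matrix_inv_mult_vector(1)[OF loewner_le_invertible[OF assms], of v]
  by (simp add: field_simps)

text \<open>Resolvent identity: the difference of the inverses of \<open>F x\<close> and
  \<open>F y\<close> is minus the inverse of \<open>F x\<close> times \<open>F x - F y\<close> times
  the inverse of \<open>F y\<close>. Each inverse costs a factor 1/\<mu>. This yields the existence
  of the constant \<open>L\<^sub>i\<close>.\<close>

lemma opnorm_lipschitz_matrix_inv:
  fixes F :: "real^'m \<Rightarrow> real^'d^'d"
  assumes "0 < \<mu>" and F: "\<And>x. \<mu> *\<^sub>R mat 1 \<preceq>\<^sub>L F x" and lip: "opnorm_lipschitz C F"
  shows "opnorm_lipschitz (C / \<mu>\<^sup>2) (\<lambda>x. matrix_inv (F x))"
  unfolding opnorm_lipschitz_def
proof (intro conjI allI)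
  show "0 \<le> C / \<mu>\<^sup>2"
    using lip by (simp add: opnorm_lipschitz_def)
  fix x y
  show "opnorm (matrix_inv (F x) - matrix_inv (F y)) \<le> C / \<mu>\<^sup>2 * norm (x - y)"
  proof (rule opnorm_leI)
    fix v
    \<comment> \<open>Replacing \<open>v\<close> by \<open>F y *v w\<close> turns the resolvent
      identity into a computation with vectors.\<close>
    define w where "w = matrix_inv (F y) *v v"
    have inv: "invertible (F z)" for z
      using \<open>0 < \<mu>\<close> F by (rule loewner_le_invertible)
    have "(matrix_inv (F x) - matrix_inv (F y)) *v v = matrix_inv (F x) *v (F y *v w) - w"
      by (simp add: w_def matrix_vector_mult_diff_rdistrib matrix_inv_mult_vector inv)
    also have "\<dots> = - (matrix_inv (F x) *v ((F x - F y) *v w))"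
      by (simp add: matrix_vector_mult_diff_rdistrib matrix_vector_mult_diff_distrib
          matrix_inv_mult_vector inv)
    finally have "norm ((matrix_inv (F x) - matrix_inv (F y)) *v v) \<le> norm ((F x - F y) *v w) / \<mu>"
      using norm_matrix_inv_mult_le[OF \<open>0 < \<mu>\<close> F] by simp
    also have "\<dots> \<le> (C * norm (x - y)) * (norm v / \<mu>) / \<mu>"
    proof (intro divide_right_mono)
      have "norm ((F x - F y) *v w) \<le> opnorm (F x - F y) * norm w"
        by (rule norm_mult_le_opnorm)
      also have "\<dots> \<le> (C * norm (x - y)) * (norm v / \<mu>)"
        using lip norm_matrix_inv_mult_le[OF \<open>0 < \<mu>\<close> F] unfolding w_def
        by (intro mult_mono) (auto simp: opnorm_lipschitz_def)
      finally show "norm ((F x - F y) *v w) \<le> (C * norm (x - y)) * (norm v / \<mu>)" .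
    qed (use \<open>0 < \<mu>\<close> in simp)
    finally show "norm ((matrix_inv (F x) - matrix_inv (F y)) *v v)
        \<le> C / \<mu>\<^sup>2 * norm (x - y) * norm v"
      by (simp add: power2_eq_square)
  qed
qed

text \<open>Perturbation theory for a linear system: \<delta> is the residual, \<beta> the change of
  the right-hand side, \<alpha> the change of the inverse. Both bounds are stated through
  \<open>b'\<close>, the data at the minimizer, which makes the final estimate a priori.\<close>

lemma approx_linear_solve_bounds:
  fixes A A' :: "real^'d^'d"
  assumes "0 < \<mu>" and A: "\<mu> *\<^sub>R mat 1 \<preceq>\<^sub>L A"
    and res: "norm (A *v q - b) \<le> \<delta>" and b: "norm (b - b') \<le> \<beta>"
    and inv: "opnorm (matrix_inv A - matrix_inv A') \<le> \<alpha>"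
  shows "norm q \<le> (norm b' + \<beta> + \<delta>) / \<mu>"
    and "norm (q - matrix_inv A' *v b') \<le> \<delta> / \<mu> + \<beta> / \<mu> + \<alpha> * norm b'"
proof -
  have "\<mu> * norm q \<le> norm (A *v q)"
    using A by (rule loewner_le_coercive)
  also have "\<dots> \<le> norm (A *v q - b) + norm (b - b') + norm b'"
    using norm_triangle_ineq[of "A *v q - b" b] norm_triangle_ineq[of "b - b'" b'] by simp
  also have "\<dots> \<le> norm b' + \<beta> + \<delta>"
    using res b by simp
  finally show "norm q \<le> (norm b' + \<beta> + \<delta>) / \<mu>"
    using \<open>0 < \<mu>\<close> by (simp add: field_simps)
  have "q - matrix_inv A' *v b' = matrix_inv A *v (A *v q - b) + matrix_inv A *v (b - b')
      + (matrix_inv A - matrix_inv A') *v b'"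
    using matrix_inv_mult_vector(2)[OF loewner_le_invertible[OF \<open>0 < \<mu>\<close> A]]
    by (simp add: matrix_vector_mult_diff_distrib matrix_vector_mult_diff_rdistrib)
  also have "norm \<dots> \<le> norm (matrix_inv A *v (A *v q - b)) + norm (matrix_inv A *v (b - b'))
      + norm ((matrix_inv A - matrix_inv A') *v b')"
    by (intro norm_triangle_le add_right_mono norm_triangle_ineq order_refl)
  also have "\<dots> \<le> \<delta> / \<mu> + \<beta> / \<mu> + \<alpha> * norm b'"
  proof (intro add_mono)
    show "norm (matrix_inv A *v (A *v q - b)) \<le> \<delta> / \<mu>"
      using norm_matrix_inv_mult_le[OF \<open>0 < \<mu>\<close> A] res \<open>0 < \<mu>\<close>
      by (meson divide_right_mono less_imp_le order_trans)
    show "norm (matrix_inv A *v (b - b')) \<le> \<beta> / \<mu>"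
      using norm_matrix_inv_mult_le[OF \<open>0 < \<mu>\<close> A] b \<open>0 < \<mu>\<close>
      by (meson divide_right_mono less_imp_le order_trans)
    show "norm ((matrix_inv A - matrix_inv A') *v b') \<le> \<alpha> * norm b'"
      using norm_mult_le_opnorm inv by (meson mult_right_mono norm_ge_zero order_trans)
  qed
  finally show "norm (q - matrix_inv A' *v b') \<le> \<delta> / \<mu> + \<beta> / \<mu> + \<alpha> * norm b'" .
qed

lemma norm_transpose_mult_diff_le:
  fixes B B' :: "real^'n^'d"
  shows "norm (transpose B *v q - transpose B' *v w)
    \<le> opnorm (B - B') * norm q + opnorm B' * norm (q - w)"
proof -
  have "transpose B *v q - transpose B' *v w
      = transpose (B - B') *v q + transpose B' *v (q - w)"
    by (simp add: transpose_def matrix_vector_mult_def vec_eq_iff left_diff_distrib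
        right_diff_distrib sum_subtractf)
  then show ?thesis
    by (metis add_mono norm_transpose_mult_le_opnorm norm_triangle_le)
qed

section \<open>Error of the approximate hypergradient\<close>

theorem theorem10:
  fixes g :: "real^'d \<Rightarrow> real^'n \<Rightarrow> real"
    and f :: "real^'d \<Rightarrow> real"
    and \<mu> L :: "real^'n \<Rightarrow> real"
    and L\<^sub>A L\<^sub>B L\<^sub>f :: real
    and \<theta> :: "real^'n"
  assumes g_C2: "\<And>\<tau>. twice_cont_diff (\<lambda>y. g y \<tau>)"
    and mu_L: "\<And>\<tau>. 0 < \<mu> \<tau>" "\<And>\<tau>. \<mu> \<tau> \<le> L \<tau>"
    and hess_lower: "\<And>y \<tau>. \<mu> \<tau> *\<^sub>R mat 1 \<preceq>\<^sub>L hess_yy g y \<tau>"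
    and hess_upper: "\<And>y \<tau>. hess_yy g y \<tau> \<preceq>\<^sub>L L \<tau> *\<^sub>R mat 1"
    and cont_g: "\<And>y. continuous_on UNIV (\<lambda>\<tau>. g y \<tau>)"
    and cont_grad: "\<And>y. continuous_on UNIV (\<lambda>\<tau>. grad_y g y \<tau>)"
    and cont_hess: "\<And>y. continuous_on UNIV (\<lambda>\<tau>. hess_yy g y \<tau>)"
    and mixed_diff: "\<And>y \<tau>. (\<lambda>\<sigma>. grad_y g y \<sigma>) differentiable (at \<tau>)"
    and lip_A: "\<And>\<tau>. opnorm_lipschitz L\<^sub>A (\<lambda>y. hess_yy g y \<tau>)"
    and lip_B: "\<And>\<tau>. opnorm_lipschitz L\<^sub>B (\<lambda>y. jac_mixed g y \<tau>)"
    and f_diff: "\<And>x. f differentiable (at x)"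
    and lip_f: "L\<^sub>f-lipschitz_on UNIV (gradient f)"
  shows "(\<exists>L\<^sub>i. opnorm_lipschitz L\<^sub>i (\<lambda>x. matrix_inv (hess_yy g x \<theta>))) \<and>
    (\<forall>L\<^sub>i \<epsilon> \<delta> x q.
       opnorm_lipschitz L\<^sub>i (\<lambda>x. matrix_inv (hess_yy g x \<theta>)) \<longrightarrow>
       0 \<le> \<epsilon> \<longrightarrow> 0 \<le> \<delta> \<longrightarrow> approx_solutions g f \<theta> \<epsilon> \<delta> x q \<longrightarrow>
       norm (approx_hypergradient g \<theta> x q - hypergradient g f \<theta>)
         \<le> error_coeff g f \<theta> (\<mu> \<theta>) L\<^sub>B L\<^sub>f L\<^sub>i (lower_minimizer g \<theta>) * \<epsilon>
           + opnorm (jac_mixed g (lower_minimizer g \<theta>) \<theta>) / \<mu> \<theta> * \<delta>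
           + L\<^sub>B * L\<^sub>f / \<mu> \<theta> * \<epsilon>\<^sup>2
           + L\<^sub>B / \<mu> \<theta> * \<delta> * \<epsilon>) \<and>
    (\<exists>K. \<forall>\<epsilon> \<delta> x q.
       0 \<le> \<epsilon> \<longrightarrow> 0 \<le> \<delta> \<longrightarrow> approx_solutions g f \<theta> \<epsilon> \<delta> x q \<longrightarrow>
       norm (approx_hypergradient g \<theta> x q - hypergradient g f \<theta>)
         \<le> K * (\<epsilon> + \<delta> + \<epsilon>\<^sup>2 + \<delta>\<^sup>2)) \<and>
    (\<forall>\<eta>>0. \<exists>\<rho>>0. \<forall>\<epsilon> \<delta> x q.
       0 \<le> \<epsilon> \<longrightarrow> \<epsilon> < \<rho> \<longrightarrow> 0 \<le> \<delta> \<longrightarrow> \<delta> < \<rho> \<longrightarrow> approx_solutions g f \<theta> \<epsilon> \<delta> x q \<longrightarrow>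
       norm (approx_hypergradient g \<theta> x q - hypergradient g f \<theta>) < \<eta>)"
proof -
  define s where "s = lower_minimizer g \<theta>"
  define m where "m = \<mu> \<theta>"
  define A where "A x = hess_yy g x \<theta>" for x
  define B where "B x = jac_mixed g x \<theta>" for x
  define G where "G = gradient f"
  define err where "err x q = norm (approx_hypergradient g \<theta> x q - hypergradient g f \<theta>)" for x q
  define c where "c L\<^sub>i = error_coeff g f \<theta> m L\<^sub>B L\<^sub>f L\<^sub>i s" for L\<^sub>i
  have m: "0 < m" and A: "m *\<^sub>R mat 1 \<preceq>\<^sub>L A x" for x
    using mu_L hess_lower by (simp_all add: m_def A_def)
  have nn: "0 \<le> L\<^sub>B" "0 \<le> L\<^sub>f" "0 \<le> opnorm (B s)"
    using lip_B lip_f by (auto simp: opnorm_lipschitz_def lipschitz_on_def opnorm_nonneg)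
  have approx: "approx_solutions g f \<theta> \<epsilon> \<delta> x q \<longleftrightarrow>
      norm (x - s) \<le> \<epsilon> \<and> norm (A x *v q - G x) \<le> \<delta>" for \<epsilon> \<delta> x q
    by (simp add: approx_solutions_def s_def A_def G_def)

  have bound: "err x q \<le> c L\<^sub>i * \<epsilon> + opnorm (B s) / m * \<delta> + L\<^sub>B * L\<^sub>f / m * \<epsilon>\<^sup>2 + L\<^sub>B / m * \<delta> * \<epsilon>"
    if Li: "opnorm_lipschitz L\<^sub>i (\<lambda>x. matrix_inv (A x))" and \<epsilon>: "0 \<le> \<epsilon>"
      and sol: "approx_solutions g f \<theta> \<epsilon> \<delta> x q"
    for L\<^sub>i \<epsilon> \<delta> x q
  proof -
    have x: "norm (x - s) \<le> \<epsilon>" and res: "norm (A x *v q - G x) \<le> \<delta>"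
      using sol by (simp_all add: approx)
    have "0 \<le> L\<^sub>i"
      using Li by (simp add: opnorm_lipschitz_def)
    have G: "norm (G x - G s) \<le> L\<^sub>f * \<epsilon>"
      using lipschitz_onD[OF lip_f, of x s] mult_left_mono[OF x \<open>0 \<le> L\<^sub>f\<close>]
      by (simp add: G_def dist_norm)
    have Ai: "opnorm (matrix_inv (A x) - matrix_inv (A s)) \<le> L\<^sub>i * \<epsilon>"
      using Li mult_left_mono[OF x \<open>0 \<le> L\<^sub>i\<close>] by (meson opnorm_lipschitz_def order_trans)
    have B: "opnorm (B x - B s) \<le> L\<^sub>B * \<epsilon>"
      using lip_B[of \<theta>] mult_left_mono[OF x \<open>0 \<le> L\<^sub>B\<close>] unfolding B_def
      by (meson opnorm_lipschitz_def order_trans)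
    have "err x q = norm (transpose (B x) *v q - transpose (B s) *v (matrix_inv (A s) *v G s))"
      by (simp add: err_def approx_hypergradient_def hypergradient_def Let_def s_def A_def B_def
          G_def norm_minus_commute)
    also have "\<dots> \<le> opnorm (B x - B s) * norm q + opnorm (B s) * norm (q - matrix_inv (A s) *v G s)"
      by (rule norm_transpose_mult_diff_le)
    also have "\<dots> \<le> (L\<^sub>B * \<epsilon>) * ((norm (G s) + L\<^sub>f * \<epsilon> + \<delta>) / m)
        + opnorm (B s) * (\<delta> / m + L\<^sub>f * \<epsilon> / m + L\<^sub>i * \<epsilon> * norm (G s))"
      using approx_linear_solve_bounds[OF m A res G Ai] B nn \<epsilon>
      by (intro add_mono mult_mono) auto
    \<comment> \<open>The first product supplies the \<open>L\<^sub>B\<close> term of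
      \<open>c L\<^sub>i\<close> and both second-order terms; the second product supplies the other
      two terms of \<open>c L\<^sub>i\<close> and the term linear in \<delta>.\<close>
    also have "\<dots> = c L\<^sub>i * \<epsilon> + opnorm (B s) / m * \<delta> + L\<^sub>B * L\<^sub>f / m * \<epsilon>\<^sup>2 + L\<^sub>B / m * \<delta> * \<epsilon>"
      using m by (simp add: c_def error_coeff_def B_def G_def field_simps power2_eq_square)
    finally show ?thesis .
  qed

  \<comment> \<open>Fixing one concrete Lipschitz constant of the inverse makes \<open>K\<close>
    below independent of \<epsilon>, \<delta>, \<open>x\<close> and \<open>q\<close>.\<close>
  define Li where "Li = L\<^sub>A / m\<^sup>2"
  have Li: "opnorm_lipschitz Li (\<lambda>x. matrix_inv (A x))"
    unfolding Li_def using m A lip_A[of \<theta>]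
    by (intro opnorm_lipschitz_matrix_inv) (auto simp: A_def)
  then have "0 \<le> c Li"
    using nn m by (simp add: c_def error_coeff_def B_def opnorm_lipschitz_def)
  \<comment> \<open>A sum of nonnegative coefficients dominates each of them;
    \<open>L\<^sub>B / m\<close> enters because the mixed term \<delta>\<epsilon> is distributed
    over both squares.\<close>
  define K where "K = c Li + opnorm (B s) / m + L\<^sub>B * L\<^sub>f / m + L\<^sub>B / m"
  have K: "c Li \<le> K" "opnorm (B s) / m \<le> K" "L\<^sub>B * L\<^sub>f / m + L\<^sub>B / m \<le> K" "L\<^sub>B / m \<le> K" "0 \<le> K"
    using nn m \<open>0 \<le> c Li\<close> by (simp_all add: K_def)
  have order: "err x q \<le> K * (\<epsilon> + \<delta> + \<epsilon>\<^sup>2 + \<delta>\<^sup>2)"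
    if \<epsilon>\<delta>: "0 \<le> \<epsilon>" "0 \<le> \<delta>" and sol: "approx_solutions g f \<theta> \<epsilon> \<delta> x q" for \<epsilon> \<delta> x q
  proof -
    have "\<delta> * \<epsilon> \<le> \<epsilon>\<^sup>2 + \<delta>\<^sup>2"
      using sum_squares_bound[of \<delta> \<epsilon>] mult_nonneg_nonneg[OF \<epsilon>\<delta>] by (simp add: algebra_simps)
    then have "L\<^sub>B / m * (\<delta> * \<epsilon>) \<le> L\<^sub>B / m * (\<epsilon>\<^sup>2 + \<delta>\<^sup>2)"
      using nn m by (intro mult_left_mono) auto
    then have "err x q \<le> c Li * \<epsilon> + opnorm (B s) / m * \<delta>
        + (L\<^sub>B * L\<^sub>f / m + L\<^sub>B / m) * \<epsilon>\<^sup>2 + L\<^sub>B / m * \<delta>\<^sup>2"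
      using bound[OF Li \<epsilon>\<delta>(1) sol] by (simp add: algebra_simps)
    also have "\<dots> \<le> K * \<epsilon> + K * \<delta> + K * \<epsilon>\<^sup>2 + K * \<delta>\<^sup>2"
      using K \<epsilon>\<delta> by (intro add_mono mult_right_mono) auto
    finally show ?thesis
      by (simp add: algebra_simps)
  qed

  have conv: "\<exists>\<rho>>0. \<forall>\<epsilon> \<delta> x q. 0 \<le> \<epsilon> \<longrightarrow> \<epsilon> < \<rho> \<longrightarrow> 0 \<le> \<delta> \<longrightarrow> \<delta> < \<rho> \<longrightarrow>
      approx_solutions g f \<theta> \<epsilon> \<delta> x q \<longrightarrow> err x q < \<eta>" if "0 < \<eta>" for \<eta>
  \<comment> \<open>The cap 1 makes each square at most its base, so the four summands total at most
    four times the radius. The \<open>+ 1\<close> in the denominator covers \<open>K = 0\<close> and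
    makes the final inequality strict.\<close>
  proof (intro exI[of _ "min 1 (\<eta> / (4 * K + 1))"] conjI allI impI)
    show "0 < min 1 (\<eta> / (4 * K + 1))"
      using \<open>0 < \<eta>\<close> \<open>0 \<le> K\<close> by simp
    fix \<epsilon> \<delta> x q
    assume \<epsilon>: "0 \<le> \<epsilon>" "\<epsilon> < min 1 (\<eta> / (4 * K + 1))" and \<delta>: "0 \<le> \<delta>" "\<delta> < min 1 (\<eta> / (4 * K + 1))"
      and sol: "approx_solutions g f \<theta> \<epsilon> \<delta> x q"
    define r where "r = \<eta> / (4 * K + 1)"
    have "0 < r"
      using \<open>0 < \<eta>\<close> \<open>0 \<le> K\<close> by (simp add: r_def)
    have "\<epsilon>\<^sup>2 \<le> \<epsilon>" "\<delta>\<^sup>2 \<le> \<delta>"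
      using \<epsilon> \<delta> by (auto simp: power2_eq_square mult_left_le)
    then have "\<epsilon> + \<delta> + \<epsilon>\<^sup>2 + \<delta>\<^sup>2 \<le> 4 * r"
      using \<epsilon> \<delta> by (simp add: r_def)
    then have "err x q \<le> K * (4 * r)"
      using order[OF \<epsilon>(1) \<delta>(1) sol] \<open>0 \<le> K\<close> by (meson mult_left_mono order_trans)
    also have "\<dots> < (4 * K + 1) * r"
      using \<open>0 < r\<close> by (simp add: algebra_simps)
    also have "\<dots> = \<eta>"
      using \<open>0 \<le> K\<close> by (simp add: r_def)
    finally show "err x q < \<eta>" .
  qed

  from Li bound order conv show ?thesis
    unfolding err_def c_def m_def A_def B_def s_def by blast
qed

end
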